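(* Let $M$ be a complete pointed metric space and $k\in\mathbb N$. If a sequence $(\gamma_n)_n\subset\mathcal{FS}_k(M)$ converges weakly to some $\gamma\in\mathcal F(M)$, then $\gamma\in\mathcal{FS}_k(M)$ and $(\gamma_n)_n$ converges to $\gamma$ in norm.
   Context: Scalars are $\mathbb K=\mathbb R$ or $\mathbb C$. For a pointed metric space $(M,d,0_M)$, $\mathrm{Lip}_0(M)$ denotes the Banach space of Lipschitz functions $g\colon M\to\mathbb K$ with $g(0_M)=0$ normed by the best Lipschitz constant; $\delta(x)\in\mathrm{Lip}_0(M)^*$ is evaluation at $x$; the Lipschitz-free space $\mathcal F(M)$ is the norm-closed linear span of $\{\delta(x):x\in M\}$ in $\mathrm{Lip}_0(M)^*$, and its dual is $\mathrm{Lip}_0(M)$. For a closed $K\subset M$ with $0_M\in K$, $\mathcal F(K)$ is identified with the closed span of $\{\delta(x):x\in K\}$ in $\mathcal F(M)$. The support $\mathrm{supp}(\gamma)$ of $\gamma\in\mathcal F(M)$ is the smallest closed $K\subset M$ with $\gamma\in\mathcal F(K)$. $\mathcal{FS}_k(M)$ is the set of $\gamma\in\mathcal F(M)$ whose support is finite with at most $k$ points; equivalently $\gamma=\sum_{i=1}^k a_i\delta(x_i)$ with $a_i\in\mathbb K$, $x_i\in M$. *)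

theory Defs
  imports "HOL-Analysis.Analysis"
begin

text \<open>Pointed metric space: the type 'a with base point p. Scalars 'k (instantiated
  to real and complex in the statement). An element of Lip0(M)^* is represented as a
  map from functions 'a => 'k to 'k; only its values on Lip0(M) matter.\<close>

definition Lip0 :: "'a::metric_space \<Rightarrow> ('a \<Rightarrow> 'k::real_normed_field) set" where
  "Lip0 p = {g. (\<exists>C. C-lipschitz_on UNIV g) \<and> g p = 0}"

definition lipnorm :: "('a::metric_space \<Rightarrow> 'k::real_normed_field) \<Rightarrow> real" where
  "lipnorm g = Inf {C. C-lipschitz_on UNIV g}"

definition dual_vals :: "'a::metric_space \<Rightarrow> (('a \<Rightarrow> 'k::real_normed_field) \<Rightarrow> 'k) \<Rightarrow> real set" where
  "dual_vals p \<phi> = {norm (\<phi> g) | g. g \<in> Lip0 p \<and> lipnorm g \<le> 1}"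

definition dual_norm :: "'a::metric_space \<Rightarrow> (('a \<Rightarrow> 'k::real_normed_field) \<Rightarrow> 'k) \<Rightarrow> real" where
  "dual_norm p \<phi> = Sup (dual_vals p \<phi>)"

definition delta :: "'a \<Rightarrow> (('a \<Rightarrow> 'k) \<Rightarrow> 'k)" where
  "delta x = (\<lambda>g. g x)"

definition delta_span :: "(('a \<Rightarrow> 'k::real_normed_field) \<Rightarrow> 'k) set" where
  "delta_span = {(\<lambda>g. \<Sum>x\<in>S. a x * delta x g) | S a. finite S}"

definition FreeSp :: "'a::metric_space \<Rightarrow> (('a \<Rightarrow> 'k::real_normed_field) \<Rightarrow> 'k) set" where
  "FreeSp p = {\<phi>. \<forall>\<epsilon>>0. \<exists>\<mu>\<in>delta_span.
      bdd_above (dual_vals p (\<lambda>g. \<phi> g - \<mu> g)) \<and> dual_norm p (\<lambda>g. \<phi> g - \<mu> g) < \<epsilon>}"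

text \<open>FS_k(M): elements of F(M) of the form sum_{i=1}^k a_i delta(x_i)
  (equality as elements of Lip0(M)^*, i.e. on Lip0(M)).\<close>
definition FS :: "'a::metric_space \<Rightarrow> nat \<Rightarrow> (('a \<Rightarrow> 'k::real_normed_field) \<Rightarrow> 'k) set" where
  "FS p k = {\<gamma>. \<gamma> \<in> FreeSp p \<and> (\<exists>S a. finite S \<and> card S \<le> k \<and>
      (\<forall>g\<in>Lip0 p. \<gamma> g = (\<Sum>x\<in>S. a x * delta x g)))}"

text \<open>Weak convergence in F(M): tested against F(M)^* = Lip0(M).\<close>
definition weak_conv :: "'a::metric_space \<Rightarrow> (nat \<Rightarrow> (('a \<Rightarrow> 'k::real_normed_field) \<Rightarrow> 'k)) \<Rightarrow> (('a \<Rightarrow> 'k) \<Rightarrow> 'k) \<Rightarrow> bool" where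
  "weak_conv p \<gamma>s \<gamma> \<longleftrightarrow> (\<forall>g\<in>Lip0 p. (\<lambda>n. \<gamma>s n g) \<longlonglongrightarrow> \<gamma> g)"

definition norm_conv :: "'a::metric_space \<Rightarrow> (nat \<Rightarrow> (('a \<Rightarrow> 'k::real_normed_field) \<Rightarrow> 'k)) \<Rightarrow> (('a \<Rightarrow> 'k) \<Rightarrow> 'k) \<Rightarrow> bool" where
  "norm_conv p \<gamma>s \<gamma> \<longleftrightarrow> (\<lambda>n. dual_norm p (\<lambda>g. \<gamma>s n g - \<gamma> g)) \<longlonglongrightarrow> 0"

end

theory Submission
  imports Defs
begin

text \<open>
  Write \<open>\<gamma>\<^sub>n = \<Sum>\<^sub>i a\<^sub>n\<^sub>,\<^sub>i \<delta>(x\<^sub>n\<^sub>,\<^sub>i)\<close>. Along a subsequence each \<open>(x\<^sub>n\<^sub>,\<^sub>i)\<^sub>n\<close> either converges or escapes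
  (eventually stays at a fixed positive distance from every given point). Let \<open>K\<close> consist of the
  base point and the limits. The heart of the matter is that \<open>\<gamma>\<^sub>n\<close> tends to 0 uniformly on the
  1-Lipschitz functions vanishing on \<open>K\<close>. If not, a layer-cake decomposition of a nonnegative test
  function \<open>u\<close> with \<open>\<bar>\<gamma>\<^sub>n(u)\<bar> \<ge> c\<close> yields a part \<open>C\<^sub>n\<close> of the support whose distance \<open>r\<^sub>n\<close> to \<open>K\<close> and to
  the rest of the support satisfies \<open>r\<^sub>n \<bar>\<gamma>\<^sub>n(C\<^sub>n)\<bar> \<ge> c/k\<close>. By the choice of \<open>K\<close>, bumps around the \<open>C\<^sub>n\<close>
  of height comparable to \<open>r\<^sub>n\<close> can be made disjoint along a further subsequence, so their sum is
  again 1-Lipschitz, and a gliding hump argument contradicts weak convergence to an element of the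
  free space. Finally, \<open>g - \<Sum>\<^sub>y\<^sub>\<in>\<^sub>K g(y) h\<^sub>y\<close> vanishes on \<open>K\<close> for fixed bumps \<open>h\<^sub>y\<close>, hence the limit is
  \<open>\<Sum>\<^sub>y\<^sub>\<in>\<^sub>K \<gamma>(h\<^sub>y) \<delta>(y)\<close> and the convergence is in norm.
\<close>

section \<open>Selecting a well-charged level set of a finite support\<close>

text \<open>Cut \<open>u\<close> into horizontal layers between its successive values. There are at
  most \<open>card S\<close> layers, and each contributes its thickness times the sum of
  \<open>a\<close> over a superlevel set, so some layer carries at least a \<open>1 / card S\<close>
  share. \<open>C\<close> is the superlevel set of that layer, which runs from height
  \<open>t\<close> to \<open>t + r\<close>.\<close>

lemma layer_cake_gap:
  fixes a :: "'a \<Rightarrow> 'k::real_normed_vector" and u :: "'a \<Rightarrow> real"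
  assumes "finite S" and "\<And>z. z \<in> S \<Longrightarrow> 0 \<le> u z"
  shows "\<exists>C t r. C \<subseteq> S \<and> 0 \<le> t \<and> 0 \<le> r \<and> (\<forall>z\<in>C. t + r \<le> u z) \<and> (\<forall>z\<in>S - C. u z \<le> t) \<and>
    norm (\<Sum>z\<in>S. u z *\<^sub>R a z) \<le> real (card S) * (r * norm (\<Sum>z\<in>C. a z))"
  using assms
proof (induction "card S" arbitrary: S u rule: less_induct)
  case less
  show ?case
  proof (cases "S = {}")
    case True
    then show ?thesis by (intro exI[of _ "{}"] exI[of _ 0]) auto
  next
    case False
    \<comment> \<open>The bottom layer has thickness \<open>m\<close> and superlevel set
      \<open>S\<close>. Removing it leaves a function supported on the strictly smaller set
      \<open>T\<close>, to which induction applies.\<close>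
    define m where "m = Min (u ` S)"
    have m_le: "m \<le> u z" if "z \<in> S" for z
      using that less.prems(1) by (simp add: m_def)
    have "m \<in> u ` S" unfolding m_def using False less.prems(1) by (intro Min_in) auto
    then obtain z0 where z0: "z0 \<in> S" "u z0 = m" by auto
    have m0: "0 \<le> m" using z0 less.prems(2) by auto
    define T where "T = {z\<in>S. m < u z}"
    have T: "T \<subseteq> S" "z0 \<notin> T" "finite T" using less.prems(1) z0 by (auto simp: T_def)
    have cT: "card T < card S"
      using T z0(1) less.prems(1) by (intro psubset_card_mono) auto
    have "\<exists>C t r. C \<subseteq> T \<and> 0 \<le> t \<and> 0 \<le> r \<and> (\<forall>z\<in>C. t + r \<le> u z - m) \<and> (\<forall>z\<in>T - C. u z - m \<le> t) \<and>
      norm (\<Sum>z\<in>T. (u z - m) *\<^sub>R a z) \<le> real (card T) * (r * norm (\<Sum>z\<in>C. a z))"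
      by (rule less.hyps[OF cT]) (use T m_le in auto)
    then obtain C t r where C: "C \<subseteq> T" "0 \<le> t" "0 \<le> r" "\<And>z. z \<in> C \<Longrightarrow> t + r \<le> u z - m"
      "\<And>z. z \<in> T - C \<Longrightarrow> u z - m \<le> t"
      and le: "norm (\<Sum>z\<in>T. (u z - m) *\<^sub>R a z) \<le> real (card T) * (r * norm (\<Sum>z\<in>C. a z))"
      by blast
    have "(\<Sum>z\<in>T. (u z - m) *\<^sub>R a z) = (\<Sum>z\<in>S. (u z - m) *\<^sub>R a z)"
      using less.prems(1) m_le by (intro sum.mono_neutral_left) (force simp: T_def)+
    then have eq: "(\<Sum>z\<in>S. u z *\<^sub>R a z) = m *\<^sub>R (\<Sum>z\<in>S. a z) + (\<Sum>z\<in>T. (u z - m) *\<^sub>R a z)"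
      by (simp add: scaleR_diff_left sum_subtractf scaleR_sum_right)
    define A where "A = m * norm (\<Sum>z\<in>S. a z)"
    define B where "B = r * norm (\<Sum>z\<in>C. a z)"
    have "norm (\<Sum>z\<in>S. u z *\<^sub>R a z) \<le> A + real (card T) * B"
      unfolding eq A_def B_def using le m0 by (intro norm_triangle_le add_mono) auto
    also have "\<dots> \<le> max A B + real (card T) * max A B"
      by (intro add_mono mult_left_mono) auto
    also have "\<dots> = (real (card T) + 1) * max A B" by (simp add: algebra_simps)
    also have "\<dots> \<le> real (card S) * max A B"
      using cT m0 by (intro mult_right_mono) (auto simp: A_def le_max_iff_disj)
    finally have bound: "norm (\<Sum>z\<in>S. u z *\<^sub>R a z) \<le> real (card S) * max A B" .
    \<comment> \<open>The winner is either the bottom layer, with \<open>C = S\<close> between 0 and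
      \<open>m\<close>, or the layer found by induction, lifted by \<open>m\<close>.\<close>
    show ?thesis
    proof (cases "B \<le> A")
      case True
      with bound m_le m0 show ?thesis
        by (intro exI[of _ S] exI[of _ 0] exI[of _ m]) (auto simp: A_def)
    next
      case False
      then have "norm (\<Sum>z\<in>S. u z *\<^sub>R a z) \<le> real (card S) * B" using bound by simp
      moreover have "u z \<le> m + t" if "z \<in> S - C" for z
        using that C(2) C(5)[of z] by (cases "z \<in> T") (auto simp: T_def)
      moreover have "m + t + r \<le> u z" if "z \<in> C" for z
        using C(4)[OF that] by simp
      ultimately show ?thesis using C(1-3) T(1) m0
        by (intro exI[of _ C] exI[of _ "m + t"] exI[of _ r]) (auto simp: B_def)
    qed
  qed
qed

section \<open>Subsequences that converge or escape\<close>

text \<open>If the range is totally bounded, its closure is compact by completeness. Otherwise a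
  subsequence is \<open>e\<close>-separated for some \<open>e\<close>, and a ball of radius
  \<open>e/2\<close> then contains at most one of its terms.\<close>

lemma convergent_or_escaping_subseq:
  fixes s :: "nat \<Rightarrow> 'a::metric_space"
  assumes "complete (UNIV :: 'a set)"
  shows "\<exists>r. strict_mono r \<and> ((\<exists>l. (\<lambda>n. s (r n)) \<longlonglongrightarrow> l) \<or>
    (\<exists>e>0. \<forall>w. \<forall>\<^sub>F n in sequentially. e \<le> dist w (s (r n))))"
proof (cases "\<forall>e>0. \<exists>k. finite k \<and> range s \<subseteq> (\<Union>x\<in>k. ball x e)")
  case True
  have "\<exists>k. finite k \<and> closure (range s) \<subseteq> (\<Union>x\<in>k. ball x e)" if "e > 0" for e
  proof -
    \<comment> \<open>Half the radius leaves room to pass to closed balls, which also cover the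
      closure.\<close>
    have "e/2 > 0" using that by simp
    then obtain k where k: "finite k" "range s \<subseteq> (\<Union>x\<in>k. ball x (e/2))"
      using True by meson
    have "closed (\<Union>x\<in>k. cball x (e/2))" using k by blast
    moreover have "range s \<subseteq> (\<Union>x\<in>k. cball x (e/2))" using k(2) ball_subset_cball by blast
    ultimately have "closure (range s) \<subseteq> (\<Union>x\<in>k. cball x (e/2))" by (rule closure_minimal[rotated])
    also have "\<dots> \<subseteq> (\<Union>x\<in>k. ball x e)" using that by force
    finally show ?thesis using k by blast
  qed
  moreover have "complete (closure (range s))"
    using complete_closed_subset[OF closed_closure subset_UNIV assms] .
  ultimately have "compact (closure (range s))"
    unfolding compact_eq_totally_bounded by blast
  then have "seq_compact (closure (range s))"
    by (rule compact_imp_seq_compact)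
  moreover have "\<forall>n. s n \<in> closure (range s)"
    by (intro allI subsetD[OF closure_subset] rangeI)
  ultimately obtain l r where "strict_mono r" "(s \<circ> r) \<longlonglongrightarrow> l"
    by (rule seq_compactE)
  then show ?thesis by (auto simp: o_def)
next
  case False
  then obtain e where e: "e > 0" "\<And>k. finite k \<Longrightarrow> \<not> range s \<subseteq> (\<Union>x\<in>k. ball x e)" by blast
  have "\<exists>f :: nat \<Rightarrow> nat. \<forall>j. \<forall>i<j. f i < f j \<and> e \<le> dist (s (f i)) (s (f j))"
  proof (rule dependent_wellorder_choice, goal_cases)
    case (2 j f)
    \<comment> \<open>Avoiding the balls around all of \<open>s 0\<close>, ..., \<open>s N\<close>,
      and not only around the chosen terms, makes the new index exceed \<open>N\<close> as well as
      giving separation.\<close>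
    define N where "N = Max (insert 0 (f ` {..<j}))"
    obtain n where n: "s n \<notin> (\<Union>x\<in>s ` {..N}. ball x e)" using e(2)[of "s ` {..N}"] by blast
    have "N < n"
    proof (rule ccontr)
      assume "\<not> N < n"
      then have "s n \<in> ball (s n) e" "s n \<in> s ` {..N}" using e(1) by auto
      then show False using n by blast
    qed
    moreover have "f i \<le> N" if "i < j" for i using that by (auto simp: N_def)
    ultimately have "f i < n \<and> e \<le> dist (s (f i)) (s n)" if "i < j" for i
      using n that by (force simp: not_less intro: le_less_trans)
    then show ?case by blast
  qed simp
  then obtain f :: "nat \<Rightarrow> nat" where f: "\<And>i j. i < j \<Longrightarrow> f i < f j"
    "\<And>i j. i < j \<Longrightarrow> e \<le> dist (s (f i)) (s (f j))" by blast
  have "\<forall>\<^sub>F n in sequentially. e/2 \<le> dist w (s (f n))" for w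
  proof (cases "\<exists>i. dist w (s (f i)) < e/2")
    case True
    then obtain i where i: "dist w (s (f i)) < e/2" by blast
    have "e/2 \<le> dist w (s (f n))" if "i < n" for n
      using f(2)[OF that] i dist_triangle3[of "s (f i)" "s (f n)" w] by linarith
    then show ?thesis by (intro eventually_mono[OF eventually_gt_at_top[of i]]) simp
  qed (auto simp: not_less)
  then have "\<exists>e>0. \<forall>w. \<forall>\<^sub>F n in sequentially. e \<le> dist w (s (f n))"
    using e(1) by (intro exI[of _ "e/2"]) auto
  then show ?thesis using f(1) by (intro exI[of _ f]) (auto simp: strict_mono_def)
qed

text \<open>Both alternatives survive passage to a further subsequence, so the \<open>k\<close>
  coordinates can be treated one after another.\<close>

lemma convergent_or_escaping_subseq_finite:
  fixes x :: "nat \<Rightarrow> nat \<Rightarrow> 'a::metric_space"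
  assumes "complete (UNIV :: 'a set)"
  shows "\<exists>r. strict_mono r \<and> (\<forall>i<k. (\<exists>l. (\<lambda>n. x (r n) i) \<longlonglongrightarrow> l) \<or>
    (\<exists>e>0. \<forall>w. \<forall>\<^sub>F n in sequentially. e \<le> dist w (x (r n) i)))"
proof (induction k)
  case 0
  show ?case by (auto intro: exI[of _ id] strict_mono_id)
next
  case (Suc k)
  let ?Q = "\<lambda>s. (\<exists>l. s \<longlonglongrightarrow> l) \<or> (\<exists>e>0. \<forall>w. \<forall>\<^sub>F n in sequentially. e \<le> dist w (s n))"
  obtain r where r: "strict_mono r" "\<And>i. i < k \<Longrightarrow> ?Q (\<lambda>n. x (r n) i)"
    using Suc by blast
  obtain q where q: "strict_mono q" "?Q (\<lambda>n. x (r (q n)) k)"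
    using convergent_or_escaping_subseq[OF assms, of "\<lambda>n. x (r n) k"] by blast
  have "?Q (\<lambda>n. x (r (q n)) i)" if "i < k" for i
    using r(2)[OF that]
  proof (elim disjE exE conjE)
    fix l assume "(\<lambda>n. x (r n) i) \<longlonglongrightarrow> l"
    from LIMSEQ_subseq_LIMSEQ[OF this q(1)] show ?thesis by (auto simp: o_def)
  next
    fix e :: real assume "e > 0" "\<forall>w. \<forall>\<^sub>F n in sequentially. e \<le> dist w (x (r n) i)"
    then show ?thesis using eventually_subseq[OF q(1)] by blast
  qed
  then show ?case using q(2) strict_mono_o[OF r(1) q(1)] unfolding o_def
    by (intro exI[of _ "\<lambda>n. r (q n)"]) (simp add: less_Suc_eq)
qed

section \<open>Bump functions, the Lipschitz unit ball and approximation in the free space\<close>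

text \<open>A cone of slope 1 with plateau \<open>C\<close>. Since \<open>infdist x {} = 0\<close>,
  an empty \<open>C\<close> would give a constant function, hence the condition
  \<open>C \<noteq> {}\<close> wherever the support is located.\<close>

definition bump :: "'a::metric_space set \<Rightarrow> real \<Rightarrow> 'a \<Rightarrow> real" where
  "bump C \<rho> x = max 0 (\<rho> - infdist x C)"

lemma bump_nonneg: "0 \<le> bump C \<rho> x"
  by (simp add: bump_def)

lemma bump_lipschitz: "1-lipschitz_on UNIV (bump C \<rho>)"
proof (rule lipschitz_onI)
  fix x y :: 'a
  show "dist (bump C \<rho> x) (bump C \<rho> y) \<le> 1 * dist x y"
    using infdist_triangle_abs[of x C y] by (auto simp: bump_def dist_real_def max_def)
qed simp

lemma bump_on: "x \<in> C \<Longrightarrow> 0 \<le> \<rho> \<Longrightarrow> bump C \<rho> x = \<rho>"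
  by (simp add: bump_def)

lemma bump_neq_0D:
  assumes "bump C \<rho> x \<noteq> 0" "C \<noteq> {}"
  obtains z where "z \<in> C" "dist x z < \<rho>"
proof -
  have "(INF z\<in>C. dist x z) < \<rho>"
    using assms by (auto simp: bump_def infdist_notempty split: if_splits)
  then show ?thesis using that assms(2) by (subst (asm) cINF_less_iff) auto
qed

lemma bump_eq_0:
  assumes "C \<noteq> {}" "\<And>z. z \<in> C \<Longrightarrow> \<rho> \<le> dist x z"
  shows "bump C \<rho> x = 0"
proof (rule ccontr)
  assume "bump C \<rho> x \<noteq> 0"
  then obtain z where "z \<in> C" "dist x z < \<rho>" using assms(1) by (rule bump_neq_0D)
  then show False using assms(2)[of z] by simp
qed

lemma Lip0I: "L-lipschitz_on UNIV g \<Longrightarrow> g p = 0 \<Longrightarrow> g \<in> Lip0 p"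
  by (auto simp: Lip0_def)

lemma Lip0E:
  assumes "g \<in> Lip0 p"
  obtains L where "L-lipschitz_on UNIV g" "g p = 0"
  using assms by (auto simp: Lip0_def)

text \<open>The infimum of all Lipschitz constants is attained: for each pair of points, constants
  arbitrarily close to it give the estimate in the limit.\<close>

lemma lipnorm_le_1_iff:
  assumes "g \<in> Lip0 p"
  shows "lipnorm g \<le> 1 \<longleftrightarrow> 1-lipschitz_on UNIV g"
proof
  assume "1-lipschitz_on UNIV g"
  then show "lipnorm g \<le> 1" unfolding lipnorm_def
    by (intro cInf_lower bdd_belowI[of _ 0]) (auto dest: lipschitz_on_nonneg)
next
  assume le: "lipnorm g \<le> 1"
  let ?X = "{C. C-lipschitz_on UNIV g}"
  have ne: "?X \<noteq> {}" using assms by (auto simp: Lip0_def)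
  show "1-lipschitz_on UNIV g"
  proof (rule lipschitz_onI)
    fix x y
    show "dist (g x) (g y) \<le> 1 * dist x y"
    proof (rule field_le_epsilon)
      fix e :: real assume "e > 0"
      \<comment> \<open>The summand 1 keeps the denominator positive when \<open>x = y\<close>; the
        excess \<open>d * dist x y\<close> stays below \<open>e\<close>.\<close>
      define d where "d = e / (dist x y + 1)"
      have "d > 0" using \<open>e > 0\<close> by (simp add: d_def add_nonneg_pos)
      then have "Inf ?X < 1 + d" using le by (simp add: lipnorm_def)
      then obtain C where C: "C-lipschitz_on UNIV g" "C < 1 + d"
        using cInf_lessD[OF ne] by blast
      have "dist (g x) (g y) \<le> C * dist x y" using lipschitz_onD[OF C(1)] by simp
      also have "\<dots> \<le> (1 + d) * dist x y" using C(2) by (intro mult_right_mono) auto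
      also have "\<dots> = dist x y + d * dist x y" by (simp add: algebra_simps)
      also have "d * dist x y \<le> d * (dist x y + 1)" using \<open>d > 0\<close> by simp
      also have "d * (dist x y + 1) = e" unfolding d_def
        by (simp add: add_nonneg_eq_0_iff)
      finally show "dist (g x) (g y) \<le> 1 * dist x y + e" by simp
    qed
  qed simp
qed

text \<open>The boundedness clause in \<open>FreeSp\<close> turns the supremum into an actual upper
  bound, so smallness of \<open>dual_norm\<close> becomes a uniform estimate on the unit
  ball.\<close>

lemma FreeSp_approx:
  assumes "\<phi> \<in> FreeSp p" "\<epsilon> > 0"
  obtains S a where "finite S"
    "\<And>g. 1-lipschitz_on UNIV g \<Longrightarrow> g p = 0 \<Longrightarrow> norm (\<phi> g - (\<Sum>x\<in>S. a x * g x)) < \<epsilon>"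
proof -
  obtain \<mu> where \<mu>: "\<mu> \<in> delta_span" "bdd_above (dual_vals p (\<lambda>g. \<phi> g - \<mu> g))"
    "dual_norm p (\<lambda>g. \<phi> g - \<mu> g) < \<epsilon>" using assms by (auto simp: FreeSp_def)
  obtain S a where S: "finite S" "\<mu> = (\<lambda>g. \<Sum>x\<in>S. a x * delta x g)"
    using \<mu>(1) by (auto simp: delta_span_def)
  have "norm (\<phi> g - (\<Sum>x\<in>S. a x * g x)) < \<epsilon>" if "1-lipschitz_on UNIV g" "g p = 0" for g
  proof -
    have "norm (\<phi> g - \<mu> g) \<in> dual_vals p (\<lambda>g. \<phi> g - \<mu> g)"
      using that Lip0I[OF that] by (auto simp: dual_vals_def lipnorm_le_1_iff[of g p])
    then have "norm (\<phi> g - \<mu> g) \<le> dual_norm p (\<lambda>g. \<phi> g - \<mu> g)"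
      unfolding dual_norm_def using \<mu>(2) by (rule cSup_upper)
    then show ?thesis using \<mu>(3) S(2) by (simp add: delta_def)
  qed
  then show ?thesis using that S(1) by blast
qed

section \<open>Sums of functions with disjoint supports\<close>

text \<open>Restricting to the nonzero terms makes the pointwise sum meaningful for infinite
  \<open>A\<close>: under disjointness at most one term remains, whereas \<open>sum\<close> over an
  infinite set is 0 by convention.\<close>

definition disjoint_sum :: "('i \<Rightarrow> 'a \<Rightarrow> real) \<Rightarrow> 'i set \<Rightarrow> 'a \<Rightarrow> real" where
  "disjoint_sum h A x = (\<Sum>j\<in>{j\<in>A. h j x \<noteq> 0}. h j x)"

lemma disjoint_sum_cases:
  assumes "\<And>i j. i \<noteq> j \<Longrightarrow> h i x = 0 \<or> h j x = 0"
  obtains (zero) "\<And>j. j \<in> A \<Longrightarrow> h j x = 0" "disjoint_sum h A x = 0"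
    | (single) j where "j \<in> A" "\<And>i. i \<noteq> j \<Longrightarrow> h i x = 0" "disjoint_sum h A x = h j x"
proof (cases "\<exists>j\<in>A. h j x \<noteq> 0")
  case True
  then obtain j where j: "j \<in> A" "h j x \<noteq> 0" by blast
  then have "{j\<in>A. h j x \<noteq> 0} = {j}" using assms by blast
  then show ?thesis using j assms by (intro single[of j]) (auto simp: disjoint_sum_def)
next
  case False
  then have "{j\<in>A. h j x \<noteq> 0} = {}" by blast
  then show ?thesis using False by (intro zero) (auto simp: disjoint_sum_def)
qed

lemma disjoint_sum_finite: "finite A \<Longrightarrow> disjoint_sum h A x = (\<Sum>j\<in>A. h j x)"
  unfolding disjoint_sum_def by (rule sum.mono_neutral_left) auto

lemma disjoint_sum_Un:
  assumes "\<And>i j. i \<noteq> j \<Longrightarrow> h i x = 0 \<or> h j x = 0" "A \<inter> B = {}"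
  shows "disjoint_sum h (A \<union> B) x = disjoint_sum h A x + disjoint_sum h B x"
proof -
  have fin: "finite {j\<in>A. h j x \<noteq> 0}" for A
  proof (cases "\<exists>j. h j x \<noteq> 0")
    case True
    then obtain j where "h j x \<noteq> 0" by blast
    then have "{j\<in>A. h j x \<noteq> 0} \<subseteq> {j}" using assms(1) by blast
    then show ?thesis by (rule finite_subset) simp
  qed simp
  have "{j\<in>A \<union> B. h j x \<noteq> 0} = {j\<in>A. h j x \<noteq> 0} \<union> {j\<in>B. h j x \<noteq> 0}" by blast
  then show ?thesis unfolding disjoint_sum_def
    using sum.union_disjoint[OF fin[of A] fin[of B]] assms(2) by auto
qed

text \<open>For nonnegative functions with disjoint supports the sum is the pointwise maximum of 0
  and the \<open>h j\<close>, so the constant 1 is preserved.\<close>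

lemma disjoint_sum_lipschitz:
  fixes h :: "'i \<Rightarrow> 'a::metric_space \<Rightarrow> real"
  assumes disj: "\<And>i j x. i \<noteq> j \<Longrightarrow> h i x = 0 \<or> h j x = 0"
    and lip: "\<And>j. 1-lipschitz_on UNIV (h j)" and nonneg: "\<And>j x. 0 \<le> h j x"
  shows "1-lipschitz_on UNIV (disjoint_sum h A)"
proof (rule lipschitz_onI)
  have nn: "0 \<le> disjoint_sum h A x" for x
    by (simp add: disjoint_sum_def nonneg sum_nonneg)
  have ge: "h j x \<le> disjoint_sum h A x" if "j \<in> A" for j x
  proof (rule disjoint_sum_cases[of h x A])
    fix i assume "i \<in> A" "\<And>j. j \<noteq> i \<Longrightarrow> h j x = 0" "disjoint_sum h A x = h i x"
    then show ?thesis using nonneg by (cases "i = j") auto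
  qed (use disj that in auto)
  have one_sided: "disjoint_sum h A x - disjoint_sum h A y \<le> dist x y" for x y
  proof (rule disjoint_sum_cases[of h x A])
    fix i assume i: "i \<in> A" "disjoint_sum h A x = h i x"
    have "h i x - h i y \<le> dist x y"
      using lipschitz_onD[OF lip, of x y i] by (simp add: dist_real_def)
    then show ?thesis using i ge[of i y] by simp
  next
    assume "disjoint_sum h A x = 0"
    then show ?thesis using nn[of y] zero_le_dist[of x y] by linarith
  qed (use disj in auto)
  fix x y
  show "dist (disjoint_sum h A x) (disjoint_sum h A y) \<le> 1 * dist x y"
    using one_sided[of x y] one_sided[of y x] by (simp add: dist_real_def dist_commute abs_le_iff)
qed simp

section \<open>Linearity of weak limits and the gliding hump\<close>

lemma lipschitz_on_of_real:
  "L-lipschitz_on U u \<Longrightarrow> L-lipschitz_on U (\<lambda>x. of_real (u x) :: 'k::real_normed_div_algebra)"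
  by (simp add: lipschitz_on_def)

lemma lipschitz_on_sum:
  fixes f :: "'i \<Rightarrow> 'a::metric_space \<Rightarrow> 'b::real_normed_vector"
  assumes "finite A" "\<And>i. i \<in> A \<Longrightarrow> (C i)-lipschitz_on U (f i)"
  shows "(\<Sum>i\<in>A. C i)-lipschitz_on U (\<lambda>x. \<Sum>i\<in>A. f i x)"
  using assms
proof (induction A rule: finite_induct)
  case (insert i A)
  then have "(C i + (\<Sum>i\<in>A. C i))-lipschitz_on U (\<lambda>x. f i x + (\<Sum>i\<in>A. f i x))"
    by (intro lipschitz_on_add) auto
  then show ?case using insert by simp
qed (simp add: lipschitz_on_def)

text \<open>Membership in \<^const>\<open>FreeSp\<close> constrains a functional only on the unit ball of \<^const>\<open>Lip0\<close>,
  so linearity has to come from the weak limit.\<close>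

lemma weak_limit_add:
  assumes weak: "\<And>g. g \<in> Lip0 p \<Longrightarrow> (\<lambda>n. \<Sum>x\<in>S n. a n x * g x) \<longlonglongrightarrow> (\<gamma> g :: 'k::real_normed_field)"
    and "f \<in> Lip0 p" "g \<in> Lip0 p"
  shows "\<gamma> (\<lambda>x. f x + g x) = \<gamma> f + \<gamma> g"
proof -
  obtain L M where "L-lipschitz_on UNIV f" "f p = 0" "M-lipschitz_on UNIV g" "g p = 0"
    using assms(2,3) by (auto simp: Lip0_def)
  then have "(\<lambda>x. f x + g x) \<in> Lip0 p"
    by (intro Lip0I[of "L + M"] lipschitz_on_add) auto
  from weak[OF this] have "(\<lambda>n. (\<Sum>x\<in>S n. a n x * f x) + (\<Sum>x\<in>S n. a n x * g x)) \<longlonglongrightarrow> \<gamma> (\<lambda>x. f x + g x)"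
    by (simp add: distrib_left sum.distrib)
  moreover have "(\<lambda>n. (\<Sum>x\<in>S n. a n x * f x) + (\<Sum>x\<in>S n. a n x * g x)) \<longlonglongrightarrow> \<gamma> f + \<gamma> g"
    using assms by (intro tendsto_add) auto
  ultimately show ?thesis by (rule LIMSEQ_unique)
qed

text \<open>Choose humps inductively and test with their infinite sum. At stage \<open>m\<close> the
  earlier humps already pair almost as in the limit, the later ones vanish on
  \<open>S (f m)\<close>, and the limit functional hardly sees the tail because it is almost
  finitely supported. The hump with index \<open>m\<close> is then left with a pairing below
  \<open>c\<close>.\<close>

lemma gliding_hump:
  fixes p :: "'a::metric_space" and \<gamma> :: "('a \<Rightarrow> 'k::real_normed_field) \<Rightarrow> 'k"
    and h :: "nat \<Rightarrow> 'a \<Rightarrow> real"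
  assumes weak: "\<And>g. g \<in> Lip0 p \<Longrightarrow> (\<lambda>n. \<Sum>x\<in>S n. a n x * g x) \<longlonglongrightarrow> \<gamma> g"
    and free: "\<gamma> \<in> FreeSp p"
    and lip: "\<And>n. n \<in> N \<Longrightarrow> 1-lipschitz_on UNIV (h n)" and hp: "\<And>n. n \<in> N \<Longrightarrow> h n p = 0"
    and nonneg: "\<And>n x. n \<in> N \<Longrightarrow> 0 \<le> h n x"
    and sel: "\<And>F b. finite F \<Longrightarrow> F \<subseteq> N \<Longrightarrow>
      \<exists>n\<in>N. b \<le> n \<and> (\<forall>m\<in>F. (\<forall>x\<in>S m. h n x = 0) \<and> (\<forall>x. h n x = 0 \<or> h m x = 0))"
    and "c > 0"
    and large: "\<And>n. n \<in> N \<Longrightarrow> c \<le> norm (\<Sum>x\<in>S n. a n x * of_real (h n x))"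
  shows False
proof -
  define T where "T n g = (\<Sum>x\<in>S n. a n x * g x)" for n g
  \<comment> \<open>The sum of the first \<open>j\<close> humps depends only on the values of
    \<open>f\<close> below \<open>j\<close>, as the recursive choice requires.\<close>
  define H :: "(nat \<Rightarrow> nat) \<Rightarrow> nat \<Rightarrow> 'a \<Rightarrow> 'k" where "H f j = (\<lambda>x. of_real (\<Sum>i<j. h (f i) x))" for f j
  have "\<exists>f. \<forall>j. f j \<in> N \<and>
      (\<forall>i<j. f i < f j \<and> (\<forall>x\<in>S (f i). h (f j) x = 0) \<and> (\<forall>x. h (f j) x = 0 \<or> h (f i) x = 0)) \<and>
      norm (T (f j) (H f j) - \<gamma> (H f j)) < c/4"
  proof (rule dependent_wellorder_choice, goal_cases)
    case (1 r f g j)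
    then have "H f j = H g j" by (simp add: H_def)
    then show ?case using 1 by simp
  next
    case (2 j f)
    then have fN: "\<And>i. i < j \<Longrightarrow> f i \<in> N" by blast
    have "(\<Sum>i<j. 1)-lipschitz_on UNIV (\<lambda>x. \<Sum>i<j. h (f i) x)"
      using lip fN by (intro lipschitz_on_sum) auto
    from lipschitz_on_of_real[OF this] have "H f j \<in> Lip0 p"
      using hp fN by (intro Lip0I) (auto simp: H_def)
    then have "\<forall>\<^sub>F n in sequentially. norm (T n (H f j) - \<gamma> (H f j)) < c/4"
      using tendstoD[OF weak, of "H f j" "c/4"] \<open>c > 0\<close> by (simp add: T_def dist_norm)
    then obtain b where b: "\<And>n. n \<ge> b \<Longrightarrow> norm (T n (H f j) - \<gamma> (H f j)) < c/4"
      by (auto simp: eventually_sequentially)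
    \<comment> \<open>Past the convergence threshold \<open>b\<close> for the earlier humps and
      strictly past all earlier indices.\<close>
    define b' where "b' = max b (Suc (Max (insert 0 (f ` {..<j}))))"
    obtain n where n: "n \<in> N" "b' \<le> n"
      "\<And>m. m \<in> f ` {..<j} \<Longrightarrow> (\<forall>x\<in>S m. h n x = 0) \<and> (\<forall>x. h n x = 0 \<or> h m x = 0)"
      using sel[OF finite_imageI[OF finite_lessThan], of f j b'] fN by blast
    have "f i < n" if "i < j" for i
    proof -
      have "f i \<le> Max (insert 0 (f ` {..<j}))" using that by (intro Max_ge) auto
      then show ?thesis using n(2) by (simp add: b'_def)
    qed
    then show ?case using n b[of n] by (intro exI[of _ n]) (auto simp: b'_def)
  qed
  then obtain f where fN: "\<And>j. f j \<in> N" and f_less: "\<And>i j. i < j \<Longrightarrow> f i < f j"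
    and f_S: "\<And>i j x. i < j \<Longrightarrow> x \<in> S (f i) \<Longrightarrow> h (f j) x = 0"
    and f_disj: "\<And>i j x. i < j \<Longrightarrow> h (f j) x = 0 \<or> h (f i) x = 0"
    and f_close: "\<And>j. norm (T (f j) (H f j) - \<gamma> (H f j)) < c/4"
    by blast
  define h' where "h' j = h (f j)" for j
  have disj: "h' i x = 0 \<or> h' j x = 0" if "i \<noteq> j" for i j x
    using that f_disj[of i j x] f_disj[of j i x] by (auto simp: h'_def neq_iff)
  define D :: "nat set \<Rightarrow> 'a \<Rightarrow> 'k" where "D A = (\<lambda>x. of_real (disjoint_sum h' A x))" for A
  have D_lip: "1-lipschitz_on UNIV (D A)" for A
    unfolding D_def using lip fN nonneg disj
    by (intro lipschitz_on_of_real disjoint_sum_lipschitz) (auto simp: h'_def)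
  have D_p: "D A p = 0" for A
    using hp fN by (simp add: D_def disjoint_sum_def h'_def)
  have D_Lip0: "D A \<in> Lip0 p" for A
    using D_lip D_p by (rule Lip0I)
  have H_eq: "H f j = D {..<j}" for j
    by (simp add: D_def H_def disjoint_sum_finite h'_def)
  have tail: "disjoint_sum h' UNIV x = disjoint_sum h' {..<m} x + disjoint_sum h' {m..} x" for m x
  proof -
    have "{..<m} \<union> {m..} = UNIV" "{..<m} \<inter> {m..} = {}" by auto
    then show ?thesis using disjoint_sum_Un[of h' x "{..<m}" "{m..}"] disj by simp
  qed
  have split: "\<gamma> (D UNIV) = \<gamma> (D {..<m}) + \<gamma> (D {m..})" for m
  proof -
    have "D UNIV = (\<lambda>x. D {..<m} x + D {m..} x)"
      by (simp add: D_def tail[of _ m])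
    then show ?thesis using weak_limit_add[OF weak D_Lip0 D_Lip0] by simp
  qed
  have hump: "T (f m) (D UNIV) = T (f m) (D {..<m}) + T (f m) (\<lambda>x. of_real (h' m x))" for m
  proof -
    have "D UNIV x = D {..<m} x + of_real (h' m x)" if "x \<in> S (f m)" for x
    proof -
      have "disjoint_sum h' {Suc m..} x = 0"
        unfolding disjoint_sum_def h'_def using f_S[OF _ that] by (intro sum.neutral) auto
      then show ?thesis using tail[of x "Suc m"] by (simp add: D_def disjoint_sum_finite)
    qed
    then show ?thesis by (simp add: T_def distrib_left flip: sum.distrib)
  qed
  have "strict_mono f" using f_less by (simp add: strict_mono_def)
  from LIMSEQ_subseq_LIMSEQ[OF weak[OF D_Lip0] this]
  have "(\<lambda>m. T (f m) (D UNIV)) \<longlonglongrightarrow> \<gamma> (D UNIV)"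
    by (simp add: o_def T_def)
  from tendstoD[OF this, of "c/4"]
  have ev1: "\<forall>\<^sub>F m in sequentially. norm (T (f m) (D UNIV) - \<gamma> (D UNIV)) < c/4"
    using \<open>c > 0\<close> by (simp add: dist_norm)
  \<comment> \<open>Every tail \<open>D {m..}\<close> is 1-Lipschitz, so one finite set
    \<open>F\<close> serves for all \<open>m\<close>. Each point of \<open>F\<close> lies in the
    support of at most one hump, so the tails eventually vanish on \<open>F\<close>.\<close>
  obtain F b where F: "finite F"
    "\<And>g. 1-lipschitz_on UNIV g \<Longrightarrow> g p = 0 \<Longrightarrow> norm (\<gamma> g - (\<Sum>x\<in>F. b x * g x)) < c/4"
    using FreeSp_approx[OF free, of "c/4"] \<open>c > 0\<close> by auto
  have "\<forall>\<^sub>F m in sequentially. \<forall>x\<in>F. D {m..} x = 0"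
  proof (rule eventually_ball_finite[OF F(1)], rule ballI)
    fix x
    show "\<forall>\<^sub>F m in sequentially. D {m..} x = 0"
    proof (cases "\<exists>j. h' j x \<noteq> 0")
      case True
      then obtain j where j: "h' j x \<noteq> 0" by blast
      have "D {m..} x = 0" if "m > j" for m
      proof -
        have "h' i x = 0" if "m \<le> i" for i using disj[of i j x] j that \<open>j < m\<close> by auto
        then show ?thesis by (simp add: D_def disjoint_sum_def)
      qed
      then show ?thesis by (intro eventually_mono[OF eventually_gt_at_top[of j]]) simp
    qed (simp add: D_def disjoint_sum_def)
  qed
  with ev1 have "\<forall>\<^sub>F m in sequentially. False"
  proof eventually_elim
    case (elim m)
    have "norm (\<gamma> (D {m..})) < c/4" using F(2)[OF D_lip D_p, of "{m..}"] elim(2) by simp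
    \<comment> \<open>Three errors remain, each below \<open>c/4\<close>: convergence on the full
      sum, the tail, and convergence on the earlier humps.\<close>
    moreover have "T (f m) (\<lambda>x. of_real (h' m x)) =
        (T (f m) (D UNIV) - \<gamma> (D UNIV)) + \<gamma> (D {m..}) - (T (f m) (D {..<m}) - \<gamma> (D {..<m}))"
      using split[of m] hump[of m] by simp
    moreover have "norm (u + v - w) \<le> norm u + norm v + norm w" for u v w :: 'k
      by (rule order_trans[OF norm_triangle_ineq4]) (simp add: norm_triangle_ineq)
    ultimately have "norm (T (f m) (\<lambda>x. of_real (h' m x))) < c/4 + c/4 + c/4"
      using f_close[of m] elim(1) unfolding H_eq by (smt (verit, best))
    moreover have "c \<le> norm (T (f m) (\<lambda>x. of_real (h' m x)))"
      using large[OF fN] by (simp add: T_def h'_def)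
    ultimately show False using \<open>c > 0\<close> by linarith
  qed
  then show False by simp
qed

text \<open>This reduces the gliding hump to metric conditions. The bump of height
  \<open>\<rho> n\<close> around \<open>C n\<close> vanishes on the rest of \<open>S n\<close>, so
  it pairs to \<open>\<rho> n\<close> times the charge of \<open>C n\<close>. Two overlapping bumps
  would have centres closer than the sum of their radii, contrary to \<open>sel\<close>.\<close>

lemma no_separated_charged_sets:
  fixes p :: "'a::metric_space" and \<gamma> :: "('a \<Rightarrow> 'k::real_normed_field) \<Rightarrow> 'k"
  assumes weak: "\<And>g. g \<in> Lip0 p \<Longrightarrow> (\<lambda>n. \<Sum>z\<in>S n. a n z * g z) \<longlonglongrightarrow> \<gamma> g"
    and free: "\<gamma> \<in> FreeSp p"
    and fin: "\<And>n. finite (S n)"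
    and C: "\<And>n. n \<in> N \<Longrightarrow> C n \<subseteq> S n" "\<And>n. n \<in> N \<Longrightarrow> C n \<noteq> {}"
    and \<rho>: "\<And>n. n \<in> N \<Longrightarrow> 0 \<le> \<rho> n"
    and own: "\<And>n z w. n \<in> N \<Longrightarrow> z \<in> C n \<Longrightarrow> w \<in> insert p (S n - C n) \<Longrightarrow> \<rho> n \<le> dist w z"
    and sel: "\<And>F b. finite F \<Longrightarrow> F \<subseteq> N \<Longrightarrow> \<exists>n\<in>N. b \<le> n \<and>
      (\<forall>m\<in>F. \<forall>z\<in>C n. \<forall>w\<in>S m. \<rho> n \<le> dist w z \<and> (w \<in> C m \<longrightarrow> \<rho> n + \<rho> m \<le> dist w z))"
    and "c > 0"
    and large: "\<And>n. n \<in> N \<Longrightarrow> c \<le> \<rho> n * norm (\<Sum>z\<in>C n. a n z)"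
  shows False
proof (rule gliding_hump[OF weak free, where N = N and h = "\<lambda>n. bump (C n) (\<rho> n)" and c = c])
  have zero: "bump (C n) (\<rho> n) w = 0" if "n \<in> N" "\<And>z. z \<in> C n \<Longrightarrow> \<rho> n \<le> dist w z" for n w
    using C(2)[OF that(1)] that(2) by (rule bump_eq_0)
  fix n assume n: "n \<in> N"
  show "1-lipschitz_on UNIV (bump (C n) (\<rho> n))" by (rule bump_lipschitz)
  show "bump (C n) (\<rho> n) p = 0" using own n by (intro zero) auto
  show "0 \<le> bump (C n) (\<rho> n) x" for x by (rule bump_nonneg)
  have "(\<Sum>x\<in>S n. a n x * of_real (bump (C n) (\<rho> n) x)) =
      (\<Sum>x\<in>C n. a n x * of_real (bump (C n) (\<rho> n) x))"
    using C(1)[OF n] fin zero[OF n] own[OF n] by (intro sum.mono_neutral_right) auto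
  also have "\<dots> = (\<Sum>x\<in>C n. a n x) * of_real (\<rho> n)"
    using \<rho>[OF n] by (simp add: bump_on sum_distrib_right)
  finally show "c \<le> norm (\<Sum>x\<in>S n. a n x * of_real (bump (C n) (\<rho> n) x))"
    using large[OF n] \<rho>[OF n] by (simp add: norm_mult mult.commute)
next
  fix F b assume F: "finite F" "F \<subseteq> N"
  obtain n where n: "n \<in> N" "b \<le> n" "\<And>m z w. m \<in> F \<Longrightarrow> z \<in> C n \<Longrightarrow> w \<in> S m \<Longrightarrow> \<rho> n \<le> dist w z"
    "\<And>m z w. m \<in> F \<Longrightarrow> z \<in> C n \<Longrightarrow> w \<in> C m \<Longrightarrow> \<rho> n + \<rho> m \<le> dist w z"
    using sel[OF F, of b] C(1) F(2) by blast
  have "bump (C n) (\<rho> n) x = 0" if "m \<in> F" "x \<in> S m" for m x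
    using C(2)[OF n(1)] n(3)[OF that(1) _ that(2)] by (rule bump_eq_0)
  moreover have "bump (C n) (\<rho> n) x = 0 \<or> bump (C m) (\<rho> m) x = 0" if m: "m \<in> F" for m x
  proof (rule ccontr)
    assume *: "\<not> ?thesis"
    have "m \<in> N" using m F(2) by blast
    from * have nz: "bump (C n) (\<rho> n) x \<noteq> 0" "bump (C m) (\<rho> m) x \<noteq> 0" by auto
    obtain z where z: "z \<in> C n" "dist x z < \<rho> n" using nz(1) C(2)[OF n(1)] by (rule bump_neq_0D)
    obtain w where w: "w \<in> C m" "dist x w < \<rho> m" using nz(2) C(2)[OF \<open>m \<in> N\<close>] by (rule bump_neq_0D)
    show False using n(4)[OF m z(1) w(1)] z(2) w(2) dist_triangle3[of w z x] by linarith
  qed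
  ultimately show "\<exists>n\<in>N. b \<le> n \<and> (\<forall>m\<in>F. (\<forall>x\<in>S m. bump (C n) (\<rho> n) x = 0) \<and>
      (\<forall>x. bump (C n) (\<rho> n) x = 0 \<or> bump (C m) (\<rho> m) x = 0))"
    using n(1,2) by blast
qed (use \<open>c > 0\<close> in auto)

section \<open>Uniform vanishing on test functions that are zero on \<open>K\<close>\<close>

text \<open>Since \<open>u n\<close> may vary with \<open>n\<close>, this is uniform convergence and
  goes beyond weak convergence. If it fails, layers supply charged sets \<open>C n\<close> with gaps
  \<open>r n\<close>. Separating different indices uses the dichotomy when the gaps are bounded, and
  the distance from the base point when they are not.\<close>

lemma nonneg_tests_vanish:
  fixes p :: "'a::metric_space" and \<gamma> :: "('a \<Rightarrow> 'k::real_normed_field) \<Rightarrow> 'k"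
    and x :: "nat \<Rightarrow> nat \<Rightarrow> 'a"
  assumes weak: "\<And>g. g \<in> Lip0 p \<Longrightarrow> (\<lambda>n. \<Sum>z\<in>x n ` {..<k}. a n z * g z) \<longlonglongrightarrow> \<gamma> g"
    and free: "\<gamma> \<in> FreeSp p"
    and pK: "p \<in> K"
    and dich: "\<And>i. i < k \<Longrightarrow> (\<exists>y\<in>K. (\<lambda>n. x n i) \<longlonglongrightarrow> y) \<or>
      (\<exists>e>0. \<forall>w. \<forall>\<^sub>F n in sequentially. e \<le> dist w (x n i))"
    and u: "\<And>n. 1-lipschitz_on UNIV (u n)" "\<And>n z. 0 \<le> u n z" "\<And>n y. y \<in> K \<Longrightarrow> u n y = 0"
  shows "(\<lambda>n. \<Sum>z\<in>x n ` {..<k}. a n z * of_real (u n z)) \<longlonglongrightarrow> 0"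
proof (rule ccontr)
  assume "\<not> ?thesis"
  then obtain c where c: "c > 0"
    "\<not> (\<forall>\<^sub>F n in sequentially. norm (\<Sum>z\<in>x n ` {..<k}. a n z * of_real (u n z)) < c)"
    by (auto simp: tendsto_iff)
  define S where "S n = x n ` {..<k}" for n
  have finS: "finite (S n)" for n by (simp add: S_def)
  have weakS: "(\<lambda>n. \<Sum>z\<in>S n. a n z * g z) \<longlonglongrightarrow> \<gamma> g" if "g \<in> Lip0 p" for g
    using weak[OF that] by (simp add: S_def)
  define N where "N = {n. c \<le> norm (\<Sum>z\<in>S n. a n z * of_real (u n z))}"
  have infN: "\<exists>n\<in>N. b \<le> n" for b
    using c(2) by (auto simp: N_def S_def eventually_sequentially not_less)
  have "k > 0"
    using infN[of 0] c(1) by (cases k) (auto simp: N_def S_def)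
  define c' where "c' = c / real k"
  have c': "c' > 0" using c(1) \<open>k > 0\<close> by (simp add: c'_def)
  have "\<forall>n. \<exists>C r. n \<in> N \<longrightarrow> C \<subseteq> S n \<and> 0 < r \<and> C \<noteq> {} \<and> c' \<le> r * norm (\<Sum>z\<in>C. a n z) \<and>
      (\<forall>z\<in>C. \<forall>w\<in>S n - C \<union> K. r \<le> dist w z)"
  proof
    fix n
    obtain C t r where *: "C \<subseteq> S n \<and> 0 \<le> t \<and> 0 \<le> r \<and> (\<forall>z\<in>C. t + r \<le> u n z) \<and>
      (\<forall>z\<in>S n - C. u n z \<le> t) \<and>
      norm (\<Sum>z\<in>S n. u n z *\<^sub>R a n z) \<le> real (card (S n)) * (r * norm (\<Sum>z\<in>C. a n z))"
      using layer_cake_gap[of "S n" "u n" "a n", OF finS u(2)] by (elim exE) (rule that)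
    then have C: "C \<subseteq> S n" "0 \<le> t" "0 \<le> r" "\<And>z. z \<in> C \<Longrightarrow> t + r \<le> u n z"
      "\<And>z. z \<in> S n - C \<Longrightarrow> u n z \<le> t"
      and le: "norm (\<Sum>z\<in>S n. u n z *\<^sub>R a n z) \<le> real (card (S n)) * (r * norm (\<Sum>z\<in>C. a n z))"
      by auto
    show "\<exists>C r. n \<in> N \<longrightarrow> C \<subseteq> S n \<and> 0 < r \<and> C \<noteq> {} \<and> c' \<le> r * norm (\<Sum>z\<in>C. a n z) \<and>
      (\<forall>z\<in>C. \<forall>w\<in>S n - C \<union> K. r \<le> dist w z)"
    proof (intro exI[of _ C] exI[of _ r] impI)
      assume "n \<in> N"
      then have "c \<le> real (card (S n)) * (r * norm (\<Sum>z\<in>C. a n z))"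
        using le by (simp add: N_def scaleR_conv_of_real mult.commute)
      also have "\<dots> \<le> real k * (r * norm (\<Sum>z\<in>C. a n z))"
        using C(3) card_image_le[of "{..<k}" "x n"] by (intro mult_right_mono) (auto simp: S_def)
      finally have large: "c' \<le> r * norm (\<Sum>z\<in>C. a n z)"
        using \<open>k > 0\<close> by (simp add: c'_def field_simps)
      then have "r \<noteq> 0" "C \<noteq> {}" using c' by auto
      \<comment> \<open>\<open>u n\<close> is at most \<open>t\<close> off \<open>C\<close> on the
        support and 0 on \<open>K\<close>, but at least \<open>t + r\<close> on \<open>C\<close>;
        being 1-Lipschitz, it needs distance \<open>r\<close> for the jump.\<close>
      moreover have "r \<le> dist w z" if "z \<in> C" "w \<in> S n - C \<union> K" for z w
      proof -
        have "u n w \<le> t" using that(2) C(2,5) u(3) by auto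
        moreover have "\<bar>u n w - u n z\<bar> \<le> dist w z"
          using lipschitz_onD[OF u(1), of w z n] by (simp add: dist_real_def)
        ultimately show ?thesis using C(4)[OF that(1)] by linarith
      qed
      ultimately show "C \<subseteq> S n \<and> 0 < r \<and> C \<noteq> {} \<and> c' \<le> r * norm (\<Sum>z\<in>C. a n z) \<and>
          (\<forall>z\<in>C. \<forall>w\<in>S n - C \<union> K. r \<le> dist w z)"
        using C(1,3) large by auto
    qed
  qed
  from choice[OF this] obtain C where "\<forall>n. \<exists>r. n \<in> N \<longrightarrow> C n \<subseteq> S n \<and> 0 < r \<and> C n \<noteq> {} \<and>
      c' \<le> r * norm (\<Sum>z\<in>C n. a n z) \<and> (\<forall>z\<in>C n. \<forall>w\<in>S n - C n \<union> K. r \<le> dist w z)" ..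
  from choice[OF this] obtain r where *: "\<forall>n. n \<in> N \<longrightarrow> C n \<subseteq> S n \<and> 0 < r n \<and> C n \<noteq> {} \<and>
      c' \<le> r n * norm (\<Sum>z\<in>C n. a n z) \<and> (\<forall>z\<in>C n. \<forall>w\<in>S n - C n \<union> K. r n \<le> dist w z)" ..
  have C: "\<And>n. n \<in> N \<Longrightarrow> C n \<subseteq> S n" and r: "\<And>n. n \<in> N \<Longrightarrow> 0 < r n"
    and Cne: "\<And>n. n \<in> N \<Longrightarrow> C n \<noteq> {}"
    and large: "\<And>n. n \<in> N \<Longrightarrow> c' \<le> r n * norm (\<Sum>z\<in>C n. a n z)"
    and gap: "\<And>n z w. n \<in> N \<Longrightarrow> z \<in> C n \<Longrightarrow> w \<in> S n - C n \<union> K \<Longrightarrow> r n \<le> dist w z"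
    using * by blast+
  show False
  proof (cases "\<exists>\<beta>. \<forall>n\<in>N. r n \<le> \<beta>")
    case True
    then obtain \<beta> where \<beta>: "\<And>n. n \<in> N \<Longrightarrow> r n \<le> \<beta>" by blast
    have "\<beta> > 0" using infN[of 0] r \<beta> by force
    \<comment> \<open>Converging indices receive the default 1, so that a single positive minimum
      \<open>e\<close> can be taken over all indices.\<close>
    have "\<forall>i. \<exists>e>0. i < k \<longrightarrow> (\<exists>y\<in>K. (\<lambda>n. x n i) \<longlonglongrightarrow> y) \<or>
        (\<forall>w. \<forall>\<^sub>F n in sequentially. e \<le> dist w (x n i))"
      using dich zero_less_one by blast
    then obtain E where E: "\<And>i. 0 < E i" "\<And>i. i < k \<Longrightarrow> (\<exists>y\<in>K. (\<lambda>n. x n i) \<longlonglongrightarrow> y) \<or>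
        (\<forall>w. \<forall>\<^sub>F n in sequentially. E i \<le> dist w (x n i))"
      by metis
    define e :: real where "e = Min (E ` {..<k})"
    have "e > 0" unfolding e_def using E(1) \<open>k > 0\<close>
      by (subst Min_gr_iff) (auto simp: lessThan_empty_iff)
    have e_le: "e \<le> E i" if "i < k" for i using that by (auto simp: e_def)
    \<comment> \<open>Near an escaping point only radii below \<open>e\<close> are safe; as \<open>r\<close> is bounded, the cap costs
        only a constant factor \<open>\<kappa>\<close>.\<close>
    define \<rho> where "\<rho> n = min (r n) e / 4" for n
    define \<kappa> where "\<kappa> = min 1 (e / \<beta>) / 4"
    have "\<kappa> > 0" using \<open>e > 0\<close> \<open>\<beta> > 0\<close> by (simp add: \<kappa>_def)
    have \<rho>_ge: "\<kappa> * r n \<le> \<rho> n" if "n \<in> N" for n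
    proof -
      have "min 1 (e / \<beta>) * r n \<le> 1 * r n" using r[OF that] by (intro mult_right_mono) auto
      moreover have "min 1 (e / \<beta>) * r n \<le> (e / \<beta>) * \<beta>"
        using r[OF that] \<beta>[OF that] \<open>e > 0\<close> \<open>\<beta> > 0\<close> by (intro mult_mono) auto
      ultimately show ?thesis using \<open>\<beta> > 0\<close> by (simp add: \<rho>_def \<kappa>_def)
    qed
    have sep: "\<forall>\<^sub>F n in sequentially. n \<in> N \<longrightarrow> x n j \<in> C n \<longrightarrow>
        \<rho> n \<le> dist w (x n j) \<and> (w \<in> C m \<longrightarrow> \<rho> n + \<rho> m \<le> dist w (x n j))"
      if "j < k" "m \<in> N" for j m w
      using E(2)[OF that(1)]
    proof
      assume "\<exists>y\<in>K. (\<lambda>n. x n j) \<longlonglongrightarrow> y"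
      then obtain y where y: "y \<in> K" "(\<lambda>n. x n j) \<longlonglongrightarrow> y" by blast
      show ?thesis
      proof (cases "w = y")
        case True
        have "\<rho> n \<le> dist w (x n j) \<and> (w \<in> C m \<longrightarrow> \<rho> n + \<rho> m \<le> dist w (x n j))"
          if "n \<in> N" "x n j \<in> C n" for n
        proof -
          \<comment> \<open>A limit point lies in \<open>K\<close>, from which \<open>C m\<close>
            keeps the positive distance \<open>r m\<close>.\<close>
          have "w \<notin> C m" using gap[OF \<open>m \<in> N\<close>, of w w] r[OF \<open>m \<in> N\<close>] y(1) True by auto
          moreover have "r n \<le> dist w (x n j)" using gap[OF that, of w] y(1) True by simp
          ultimately show ?thesis using r[OF that(1)] by (auto simp: \<rho>_def)
        qed
        then show ?thesis by auto
      next
        case False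
        \<comment> \<open>Once \<open>x n j\<close> is within \<open>\<eta>\<close> of
          \<open>y\<close>, its distance to \<open>w\<close> exceeds \<open>\<eta>\<close>, while
          \<open>r n < \<eta>\<close> and, for \<open>w\<close> in \<open>C m\<close>,
          \<open>r m \<le> 2 * \<eta>\<close>. The quarter in \<open>\<rho>\<close> makes both radii
          fit.\<close>
        define \<eta> where "\<eta> = dist w y / 2"
        have "\<eta> > 0" using False by (simp add: \<eta>_def)
        from tendstoD[OF y(2) this] show ?thesis
        proof (rule eventually_mono, intro impI)
          fix n assume n: "dist (x n j) y < \<eta>" "n \<in> N" "x n j \<in> C n"
          have "r n \<le> dist y (x n j)" using gap[OF n(2,3), of y] y(1) by simp
          moreover have "r m \<le> 2 * \<eta>" if "w \<in> C m"
            using gap[OF \<open>m \<in> N\<close> that, of y] y(1) by (simp add: \<eta>_def dist_commute)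
          moreover have "2 * \<eta> \<le> dist w (x n j) + dist (x n j) y"
            using dist_triangle[of w y "x n j"] by (simp add: \<eta>_def)
          ultimately show "\<rho> n \<le> dist w (x n j) \<and> (w \<in> C m \<longrightarrow> \<rho> n + \<rho> m \<le> dist w (x n j))"
            using n(1) r[OF n(2)] r[OF \<open>m \<in> N\<close>] \<open>\<eta> > 0\<close> by (auto simp: \<rho>_def dist_commute)
        qed
      qed
    next
      assume "\<forall>w. \<forall>\<^sub>F n in sequentially. E j \<le> dist w (x n j)"
      then have "\<forall>\<^sub>F n in sequentially. E j \<le> dist w (x n j)" by blast
      then show ?thesis
        by (rule eventually_mono) (use e_le[OF that(1)] \<open>e > 0\<close> in \<open>auto simp: \<rho>_def\<close>)
    qed
    show False
    proof (rule no_separated_charged_sets[OF weakS free finS, where N = N and C = C and \<rho> = \<rho> and c = "\<kappa> * c'"])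
      fix F b assume F: "finite F" "F \<subseteq> N"
      have "\<forall>\<^sub>F n in sequentially. \<forall>m\<in>F. \<forall>j\<in>{..<k}. \<forall>w\<in>S m. n \<in> N \<longrightarrow> x n j \<in> C n \<longrightarrow>
        \<rho> n \<le> dist w (x n j) \<and> (w \<in> C m \<longrightarrow> \<rho> n + \<rho> m \<le> dist w (x n j))"
        using F finS sep by (intro eventually_ball_finite ballI finite_lessThan) auto
      then obtain b' where b': "\<And>n m j w. n \<ge> b' \<Longrightarrow> m \<in> F \<Longrightarrow> j < k \<Longrightarrow> w \<in> S m \<Longrightarrow> n \<in> N \<Longrightarrow> x n j \<in> C n \<Longrightarrow>
        \<rho> n \<le> dist w (x n j) \<and> (w \<in> C m \<longrightarrow> \<rho> n + \<rho> m \<le> dist w (x n j))"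
        unfolding eventually_sequentially by (meson lessThan_iff)
      obtain n where n: "n \<in> N" "max b b' \<le> n" using infN by blast
      have "\<rho> n \<le> dist w z \<and> (w \<in> C m \<longrightarrow> \<rho> n + \<rho> m \<le> dist w z)"
        if "m \<in> F" "z \<in> C n" "w \<in> S m" for m z w
      proof -
        from C[OF n(1)] that(2) obtain j where "j < k" "z = x n j" by (auto simp: S_def)
        then show ?thesis using b'[of n m j w] n that by simp
      qed
      then show "\<exists>n\<in>N. b \<le> n \<and> (\<forall>m\<in>F. \<forall>z\<in>C n. \<forall>w\<in>S m. \<rho> n \<le> dist w z \<and> (w \<in> C m \<longrightarrow> \<rho> n + \<rho> m \<le> dist w z))"
        using n by auto
    next
      fix n assume n: "n \<in> N"
      show "0 \<le> \<rho> n" using r[OF n] \<open>e > 0\<close> by (simp add: \<rho>_def)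
      show "\<rho> n \<le> dist w z" if "z \<in> C n" "w \<in> insert p (S n - C n)" for z w
      proof -
        have "r n \<le> dist w z" using gap[OF n that(1), of w] that(2) pK by auto
        then show ?thesis using r[OF n] by (auto simp: \<rho>_def)
      qed
      have "\<kappa> * c' \<le> \<kappa> * (r n * norm (\<Sum>z\<in>C n. a n z))"
        using large[OF n] \<open>\<kappa> > 0\<close> by simp
      also have "\<dots> \<le> \<rho> n * norm (\<Sum>z\<in>C n. a n z)"
        using mult_right_mono[OF \<rho>_ge[OF n] norm_ge_zero[of "\<Sum>z\<in>C n. a n z"]] by (simp add: mult.assoc)
      finally show "\<kappa> * c' \<le> \<rho> n * norm (\<Sum>z\<in>C n. a n z)" .
    qed (use C Cne \<open>\<kappa> > 0\<close> c' in auto)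
  next
    case False
    \<comment> \<open>Large \<open>r n\<close> pushes \<open>C n\<close> away from the base point, hence from any bounded set.\<close>
    then have unb: "\<exists>n\<in>N. R < r n" for R by (meson not_le)
    show False
    proof (rule no_separated_charged_sets[OF weakS free finS, where N = N and C = C and \<rho> = "\<lambda>n. r n / 4" and c = "c' / 4"])
      fix F b assume F: "finite F" "F \<subseteq> N"
      have "finite (\<Union>m\<in>F. (\<lambda>w. dist w p + r m) ` S m)" using F finS by auto
      from bdd_above_finite[OF this] obtain R0
        where R0: "\<And>m w. m \<in> F \<Longrightarrow> w \<in> S m \<Longrightarrow> dist w p + r m \<le> R0"
        by (auto simp: bdd_above_def)
      define R where "R = max 0 R0"
      have R: "0 \<le> R" "\<And>m w. m \<in> F \<Longrightarrow> w \<in> S m \<Longrightarrow> dist w p + r m \<le> R"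
        using R0 by (force simp: R_def)+
      \<comment> \<open>Including \<open>r i\<close> for all \<open>i < b\<close> forces
        \<open>b \<le> n\<close> once \<open>r n\<close> exceeds \<open>R'\<close>. The bound
        \<open>2 * R\<close> leaves \<open>dist w z\<close> above \<open>r n / 2\<close>, with
        \<open>r m\<close> below \<open>r n / 2\<close>.\<close>
      define R' where "R' = Max (insert (2 * R) (r ` {..<b}))"
      have R'_ge: "2 * R \<le> R'" "\<And>n. n < b \<Longrightarrow> r n \<le> R'" by (auto simp: R'_def)
      obtain n where n: "n \<in> N" "R' < r n" using unb by blast
      have "b \<le> n" using R'_ge(2)[of n] n(2) by force
      moreover have "r n / 4 \<le> dist w z \<and> (w \<in> C m \<longrightarrow> r n / 4 + r m / 4 \<le> dist w z)"
        if "m \<in> F" "z \<in> C n" "w \<in> S m" for m z w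
      proof -
        have "r n \<le> dist p z" using gap[OF n(1) that(2)] pK by blast
        moreover have "dist p z \<le> dist w p + dist w z" using dist_triangle3[of p z w] by simp
        moreover have "0 < r m" using r F(2) that(1) by blast
        ultimately have "r n / 4 + r m / 4 \<le> dist w z"
          using R(2)[OF that(1,3)] R(1) R'_ge(1) n(2) zero_le_dist[of w p] by linarith
        then show ?thesis using \<open>0 < r m\<close> by auto
      qed
      ultimately show "\<exists>n\<in>N. b \<le> n \<and>
          (\<forall>m\<in>F. \<forall>z\<in>C n. \<forall>w\<in>S m. r n / 4 \<le> dist w z \<and> (w \<in> C m \<longrightarrow> r n / 4 + r m / 4 \<le> dist w z))"
        using n(1) by auto
    next
      fix n assume n: "n \<in> N"
      show "0 \<le> r n / 4" using r[OF n] by simp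
      show "r n / 4 \<le> dist w z" if "z \<in> C n" "w \<in> insert p (S n - C n)" for z w
      proof -
        have "r n \<le> dist w z" using gap[OF n that(1), of w] that(2) pK by auto
        then show ?thesis using r[OF n] by simp
      qed
      show "c' / 4 \<le> r n / 4 * norm (\<Sum>z\<in>C n. a n z)" using large[OF n] by simp
    qed (use C Cne c' in auto)
  qed
qed

text \<open>Split a scalar test function into coordinates along \<open>Basis\<close> and these into
  positive and negative parts; this treats real and complex scalars together.\<close>

lemma tests_vanish:
  fixes p :: "'a::metric_space"
    and \<gamma> :: "('a \<Rightarrow> 'k::{real_normed_field,euclidean_space}) \<Rightarrow> 'k"
    and x :: "nat \<Rightarrow> nat \<Rightarrow> 'a"
  assumes weak: "\<And>g. g \<in> Lip0 p \<Longrightarrow> (\<lambda>n. \<Sum>z\<in>x n ` {..<k}. a n z * g z) \<longlonglongrightarrow> \<gamma> g"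
    and free: "\<gamma> \<in> FreeSp p"
    and pK: "p \<in> K"
    and dich: "\<And>i. i < k \<Longrightarrow> (\<exists>y\<in>K. (\<lambda>n. x n i) \<longlonglongrightarrow> y) \<or>
      (\<exists>e>0. \<forall>w. \<forall>\<^sub>F n in sequentially. e \<le> dist w (x n i))"
    and g: "\<And>n. L-lipschitz_on UNIV (g n)" "\<And>n y. y \<in> K \<Longrightarrow> g n y = 0"
  shows "(\<lambda>n. \<Sum>z\<in>x n ` {..<k}. a n z * g n z) \<longlonglongrightarrow> 0"
proof -
  \<comment> \<open>The maximum with 1 allows division by \<open>M\<close> even when
    \<open>L = 0\<close>.\<close>
  define M where "M = max L 1"
  have M: "M > 0" "L \<le> M" by (auto simp: M_def)
  define u where "u s b n z = max 0 (s * (g n z \<bullet> b)) / M" for s b n z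
  define P where "P s b n = (\<Sum>z\<in>x n ` {..<k}. a n z * of_real (u s b n z))" for s b n
  have P: "P s b \<longlonglongrightarrow> 0" if s: "\<bar>s\<bar> = 1" and b: "b \<in> Basis" for s b
    unfolding P_def
  proof (rule nonneg_tests_vanish[OF weak free pK dich])
    show "1-lipschitz_on UNIV (u s b n)" for n
    proof (rule lipschitz_onI)
      fix v w
      have "\<bar>max 0 (s * (g n v \<bullet> b)) - max 0 (s * (g n w \<bullet> b))\<bar> \<le> \<bar>s * (g n v \<bullet> b) - s * (g n w \<bullet> b)\<bar>"
        by (auto simp: max_def)
      also have "\<dots> = \<bar>(g n v - g n w) \<bullet> b\<bar>"
        using s by (simp add: abs_mult inner_diff_left flip: right_diff_distrib)
      also have "\<dots> \<le> dist (g n v) (g n w)"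
        using Basis_le_norm[OF b] by (simp add: dist_norm)
      also have "\<dots> \<le> L * dist v w" using lipschitz_onD[OF g(1)] by simp
      also have "\<dots> \<le> M * dist v w" using M by (intro mult_right_mono) auto
      finally show "dist (u s b n v) (u s b n w) \<le> 1 * dist v w"
        using M by (simp add: u_def dist_real_def field_simps flip: diff_divide_distrib)
    qed simp
    show "0 \<le> u s b n z" for n z using M by (simp add: u_def)
    show "u s b n y = 0" if "y \<in> K" for n y using g(2)[OF that] by (simp add: u_def)
  qed
  have eq: "(\<Sum>z\<in>x n ` {..<k}. a n z * g n z) = (\<Sum>b\<in>Basis. of_real M * (P 1 b n - P (- 1) b n) * b)" for n
  proof -
    have "g n z = (\<Sum>b\<in>Basis. of_real M * (of_real (u 1 b n z) - of_real (u (- 1) b n z)) * b)" for z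
    proof -
      have "M * (u 1 b n z - u (- 1) b n z) = g n z \<bullet> b" for b
        using M by (auto simp: u_def max_def field_simps)
      then have "(\<Sum>b\<in>Basis. of_real M * (of_real (u 1 b n z) - of_real (u (- 1) b n z)) * b) =
          (\<Sum>b\<in>Basis. (g n z \<bullet> b) *\<^sub>R b)"
        by (simp add: scaleR_conv_of_real flip: of_real_diff of_real_mult)
      then show ?thesis by (simp add: euclidean_representation)
    qed
    then have "(\<Sum>z\<in>x n ` {..<k}. a n z * g n z) = (\<Sum>z\<in>x n ` {..<k}. \<Sum>b\<in>Basis.
        of_real M * (a n z * of_real (u 1 b n z) - a n z * of_real (u (- 1) b n z)) * b)"
      by (simp add: sum_distrib_left algebra_simps)
    also have "\<dots> = (\<Sum>b\<in>Basis. of_real M * (P 1 b n - P (- 1) b n) * b)"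
      unfolding P_def
      by (subst sum.swap) (simp add: sum_distrib_left sum_distrib_right sum_subtractf[symmetric])
    finally show ?thesis .
  qed
  have "(\<lambda>n. \<Sum>b\<in>Basis. of_real M * (P 1 b n - P (- 1) b n) * b) \<longlonglongrightarrow> (\<Sum>b\<in>Basis. of_real M * (0 - 0) * b)"
    by (intro tendsto_intros P) auto
  then show ?thesis by (simp add: eq)
qed

section \<open>Identifying the limit and norm convergence\<close>

text \<open>Exactly \<open>k\<close> indices are wanted for all members of a sequence. Surplus
  points get coefficient 0, and summing over the image set counts repeated points once.\<close>

lemma FS_enumerate:
  assumes "\<gamma> \<in> FS p k"
  shows "\<exists>(x :: nat \<Rightarrow> 'a::metric_space) a. \<forall>g\<in>Lip0 p. \<gamma> g = (\<Sum>z\<in>x ` {..<k}. a z * g z)"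
proof -
  obtain S a where S: "finite S" "card S \<le> k" "\<And>g. g \<in> Lip0 p \<Longrightarrow> \<gamma> g = (\<Sum>z\<in>S. a z * g z)"
    using assms by (auto simp: FS_def delta_def)
  obtain x where "bij_betw x {0..<card S} S" using ex_bij_betw_nat_finite[OF S(1)] by blast
  then have "S = x ` {..<card S}" by (simp add: bij_betw_def atLeast0LessThan)
  also have "\<dots> \<subseteq> x ` {..<k}" using S(2) by auto
  finally have sub: "S \<subseteq> x ` {..<k}" .
  define a' where "a' z = (if z \<in> S then a z else 0)" for z
  have "(\<Sum>z\<in>x ` {..<k}. a' z * g z) = (\<Sum>z\<in>S. a' z * g z)" for g
    using sub by (intro sum.mono_neutral_right) (auto simp: a'_def)
  moreover have "(\<Sum>z\<in>S. a' z * g z) = (\<Sum>z\<in>S. a z * g z)" for g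
    by (simp add: a'_def)
  ultimately show ?thesis using S(3) by (intro exI[of _ x] exI[of _ a']) simp
qed

lemma lipschitz_on_mult_left:
  fixes f :: "'a::metric_space \<Rightarrow> 'k::real_normed_field"
  assumes "C-lipschitz_on U f"
  shows "(norm c * C)-lipschitz_on U (\<lambda>x. c * f x)"
  using assms
  by (auto simp: lipschitz_on_def dist_norm norm_mult mult.assoc simp flip: right_diff_distrib
      intro!: mult_left_mono)

text \<open>The set \<open>K\<close> of limit points exists only along a subsequence. That suffices
  to identify the weak limit, and norm convergence is first obtained there.\<close>

lemma weak_limit_subseq:
  fixes p :: "'a::metric_space"
    and \<gamma> :: "('a \<Rightarrow> 'k::{real_normed_field,euclidean_space}) \<Rightarrow> 'k"
  assumes compl: "complete (UNIV :: 'a set)"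
    and FS: "\<And>n. \<gamma>s n \<in> FS p k" and free: "\<gamma> \<in> FreeSp p" and wc: "weak_conv p \<gamma>s \<gamma>"
  shows "\<gamma> \<in> FS p k \<and> (\<exists>r. strict_mono r \<and> (\<lambda>n. dual_norm p (\<lambda>g. \<gamma>s (r n) g - \<gamma> g)) \<longlonglongrightarrow> 0)"
proof -
  have "\<forall>n. \<exists>x a. \<forall>g\<in>Lip0 p. \<gamma>s n g = (\<Sum>z\<in>x ` {..<k}. a z * g z)"
    using FS_enumerate[OF FS] by blast
  from choice[OF this] obtain X where "\<forall>n. \<exists>a. \<forall>g\<in>Lip0 p. \<gamma>s n g = (\<Sum>z\<in>X n ` {..<k}. a z * g z)" ..
  from choice[OF this] obtain A where XA: "\<forall>n. \<forall>g\<in>Lip0 p. \<gamma>s n g = (\<Sum>z\<in>X n ` {..<k}. A n z * g z)" ..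
  obtain r where r: "strict_mono r" and dich0: "\<And>i. i < k \<Longrightarrow> (\<exists>l. (\<lambda>n. X (r n) i) \<longlonglongrightarrow> l) \<or>
    (\<exists>e>0. \<forall>w. \<forall>\<^sub>F n in sequentially. e \<le> dist w (X (r n) i))"
    using convergent_or_escaping_subseq_finite[OF compl, of k X] by blast
  define x where "x n = X (r n)" for n
  define a where "a n = A (r n)" for n
  define T where "T n g = (\<Sum>z\<in>x n ` {..<k}. a n z * g z)" for n g
  have T_eq: "\<gamma>s (r n) g = T n g" if "g \<in> Lip0 p" for n g
    using XA that by (simp add: T_def x_def a_def)
  have T_lim: "(\<lambda>n. T n g) \<longlonglongrightarrow> \<gamma> g" if "g \<in> Lip0 p" for g
    using LIMSEQ_subseq_LIMSEQ[OF _ r, of "\<lambda>n. \<gamma>s n g"] wc that by (simp add: weak_conv_def T_eq[OF that] o_def)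
  define K where "K = {y. \<exists>i<k. (\<lambda>n. x n i) \<longlonglongrightarrow> y}"
  have "K \<subseteq> (\<lambda>i. lim (\<lambda>n. x n i)) ` {..<k}"
    unfolding K_def by (force dest: limI)
  then have K: "finite K" "card K \<le> k"
    using surj_card_le[of "{..<k}" K] by (auto intro: finite_subset)
  \<comment> \<open>Evaluation at \<open>p\<close> is zero on \<open>Lip0 p\<close>. Dropping
    \<open>p\<close> keeps the count at most \<open>k\<close> and makes the bumps at the remaining
    points vanish at \<open>p\<close>.\<close>
  define Q where "Q = K - {p}"
  have "card Q \<le> card K" unfolding Q_def using K(1) by (intro card_mono) auto
  then have Q: "finite Q" "card Q \<le> k" "p \<notin> Q" "insert p K = insert p Q"
    using K by (auto simp: Q_def)
  have dich: "(\<exists>y\<in>insert p Q. (\<lambda>n. x n i) \<longlonglongrightarrow> y) \<or> (\<exists>e>0. \<forall>w. \<forall>\<^sub>F n in sequentially. e \<le> dist w (x n i))"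
    if "i < k" for i
    using dich0[OF that] that unfolding x_def[symmetric] Q(4)[symmetric] K_def by blast

  have "\<forall>y. \<exists>d>0. \<forall>z\<in>insert p Q. z \<noteq> y \<longrightarrow> d \<le> dist y z"
    using finite_set_avoid[of "insert p Q"] Q(1) by simp
  then obtain d where d: "\<And>y. 0 < d y" "\<And>y z. z \<in> insert p Q \<Longrightarrow> z \<noteq> y \<Longrightarrow> d y \<le> dist y z"
    by metis
  define h :: "'a \<Rightarrow> 'a \<Rightarrow> 'k" where "h y = (\<lambda>z. of_real (bump {y} (d y) z / d y))" for y
  have h_lip: "(1 / d y)-lipschitz_on UNIV (h y)" for y
    unfolding h_def using lipschitz_on_cmult_real_nonneg[OF bump_lipschitz, of "1 / d y" "{y}" "d y"] d(1)[of y]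
    by (intro lipschitz_on_of_real) simp
  have h_y: "h y y = 1" for y
    using d(1)[of y] by (simp add: h_def bump_on)
  have h_z: "h y z = 0" if "z \<in> insert p Q" "z \<noteq> y" for y z
    using bump_eq_0[of "{y}" "d y" z] d(2)[OF that] by (simp add: h_def dist_commute)
  have h_Lip0: "h y \<in> Lip0 p" if "y \<in> Q" for y
    using that Q(3) by (intro Lip0I[OF h_lip] h_z) auto

  \<comment> \<open>\<open>E g\<close> interpolates \<open>g\<close> on \<open>insert p Q\<close>
    when \<open>g p = 0\<close>. Since \<open>norm (g y) \<le> L * dist y p\<close>, the remainder
    has Lipschitz constant \<open>L * B\<close> with \<open>B\<close> independent of
    \<open>g\<close>, as uniform vanishing requires.\<close>
  define E where "E g = (\<lambda>z. \<Sum>y\<in>Q. g y * h y z)" for g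
  define B where "B = 1 + (\<Sum>y\<in>Q. dist y p * (1 / d y))"
  have rem_0: "g y - E g y = 0" if "g p = 0" "y \<in> insert p Q" for g y
  proof (cases "y = p")
    case True
    have "h w p = 0" if "w \<in> Q" for w using h_z[of p w] that Q(3) by auto
    then show ?thesis using that(1) True by (simp add: E_def)
  next
    case False
    then have "y \<in> Q" using that(2) by blast
    have "E g y = (\<Sum>w\<in>Q. if w = y then g y else 0)"
      unfolding E_def using \<open>y \<in> Q\<close> h_z h_y by (intro sum.cong) auto
    then show ?thesis using Q(1) \<open>y \<in> Q\<close> by simp
  qed
  have rem_lip: "(L * B)-lipschitz_on UNIV (\<lambda>z. g z - E g z)" if L: "L-lipschitz_on UNIV g" "g p = 0" for L g
  proof -
    have "L \<ge> 0" using lipschitz_on_nonneg[OF L(1)] .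
    have "(L * (\<Sum>y\<in>Q. dist y p * (1 / d y)))-lipschitz_on UNIV (E g)"
      unfolding E_def sum_distrib_left
    proof (rule lipschitz_on_sum[OF Q(1)])
      fix y
      have "norm (g y) \<le> L * dist y p" using lipschitz_onD[OF L(1), of y p] L(2) by simp
      then have "norm (g y) * (1 / d y) \<le> L * (dist y p * (1 / d y))"
        using d(1)[of y] by (simp add: divide_right_mono)
      with lipschitz_on_mult_left[OF h_lip]
      show "(L * (dist y p * (1 / d y)))-lipschitz_on UNIV (\<lambda>z. g y * h y z)"
        by (rule lipschitz_on_le)
    qed
    from lipschitz_on_diff[OF L(1) this] show ?thesis by (simp add: B_def distrib_left)
  qed
  have vanish: "(\<lambda>n. T n (\<lambda>z. g n z - E (g n) z)) \<longlonglongrightarrow> 0"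
    if "\<And>n. L-lipschitz_on UNIV (g n)" "\<And>n. g n p = 0" for L and g :: "nat \<Rightarrow> 'a \<Rightarrow> 'k"
    unfolding T_def
    by (rule tests_vanish[OF T_lim[unfolded T_def] free _ dich])
      (use that rem_lip rem_0 in auto)
  have T_split: "T n g = T n (\<lambda>z. g z - E g z) + (\<Sum>y\<in>Q. g y * T n (h y))" for n g
  proof -
    have "T n (E g) = (\<Sum>y\<in>Q. g y * T n (h y))"
      unfolding T_def E_def sum_distrib_left by (subst sum.swap) (simp add: algebra_simps)
    moreover have "T n (\<lambda>z. g z - E g z) = T n g - T n (E g)"
      by (simp add: T_def right_diff_distrib sum_subtractf)
    ultimately show ?thesis by simp
  qed
  have \<gamma>_eq: "\<gamma> g = (\<Sum>y\<in>Q. \<gamma> (h y) * g y)" if g: "g \<in> Lip0 p" for g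
  proof -
    obtain L where L: "L-lipschitz_on UNIV g" "g p = 0" using g by (rule Lip0E)
    have "(\<lambda>n. T n (\<lambda>z. g z - E g z) + (\<Sum>y\<in>Q. g y * T n (h y))) \<longlonglongrightarrow> 0 + (\<Sum>y\<in>Q. g y * \<gamma> (h y))"
      using vanish[of L "\<lambda>_. g"] L h_Lip0 by (intro tendsto_intros T_lim) auto
    then have "(\<lambda>n. T n g) \<longlonglongrightarrow> (\<Sum>y\<in>Q. \<gamma> (h y) * g y)"
      by (simp add: T_split[of _ g] mult.commute)
    then show ?thesis by (rule LIMSEQ_unique[OF T_lim[OF g]])
  qed
  have "\<gamma> \<in> FS p k"
    unfolding FS_def using free Q(1,2) \<gamma>_eq
    by (intro CollectI conjI exI[of _ Q] exI[of _ "\<lambda>y. \<gamma> (h y)"]) (auto simp: delta_def)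

  moreover have "(\<lambda>n. dual_norm p (\<lambda>g. \<gamma>s (r n) g - \<gamma> g)) \<longlonglongrightarrow> 0"
  proof -
    define \<phi> where "\<phi> n g = \<gamma>s (r n) g - \<gamma> g" for n g
    define V where "V n = dual_vals p (\<phi> n)" for n
    have zero_Lip0: "(\<lambda>_. 0) \<in> Lip0 p" by (intro Lip0I[OF lipschitz_on_constant]) simp
    \<comment> \<open>Nonemptiness here and boundedness below make \<open>Sup (V n)\<close> a
      genuine supremum; the element 0 also gives its lower bound.\<close>
    have V0: "0 \<in> V n" for n
    proof -
      have "\<phi> n (\<lambda>_. 0) = 0" using T_eq[OF zero_Lip0] \<gamma>_eq[OF zero_Lip0] by (simp add: \<phi>_def T_def)
      moreover have "lipnorm (\<lambda>_::'a. 0::'k) \<le> 1"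
        using lipnorm_le_1_iff[OF zero_Lip0] by (simp add: lipschitz_on_def)
      ultimately show ?thesis using zero_Lip0 unfolding V_def dual_vals_def
        by (intro CollectI exI[of _ "\<lambda>_. 0"]) simp
    qed
    have size: "norm (g z) \<le> dist z p" if "1-lipschitz_on UNIV g" "g p = 0" for g :: "'a \<Rightarrow> 'k" and z
      using lipschitz_onD[OF that(1), of z p] that(2) by simp
    have bdd: "bdd_above (V n)" for n
    proof (rule bdd_aboveI)
      fix v assume "v \<in> V n"
      then obtain g where g: "g \<in> Lip0 p" "lipnorm g \<le> 1" "v = norm (\<phi> n g)"
        by (auto simp: V_def dual_vals_def)
      have lip: "1-lipschitz_on UNIV g" "g p = 0" using g lipnorm_le_1_iff[OF g(1)] by (auto simp: Lip0_def)
      have "v \<le> norm (T n g) + norm (\<gamma> g)"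
        using g by (simp add: \<phi>_def T_eq norm_triangle_ineq4)
      also have "norm (T n g) \<le> (\<Sum>z\<in>x n ` {..<k}. norm (a n z) * dist z p)"
        unfolding T_def using size[OF lip]
        by (intro order_trans[OF norm_sum] sum_mono) (auto simp: norm_mult intro!: mult_left_mono)
      also have "norm (\<gamma> g) \<le> (\<Sum>y\<in>Q. norm (\<gamma> (h y)) * dist y p)"
        unfolding \<gamma>_eq[OF g(1)] using size[OF lip]
        by (intro order_trans[OF norm_sum] sum_mono) (auto simp: norm_mult intro!: mult_left_mono)
      finally show "v \<le> (\<Sum>z\<in>x n ` {..<k}. norm (a n z) * dist z p) + (\<Sum>y\<in>Q. norm (\<gamma> (h y)) * dist y p)"
        by simp
    qed
    \<comment> \<open>Near-maximizers, with an error tending to 0, turn norm convergence into a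
      statement about one sequence of test functions.\<close>
    have "\<forall>n. \<exists>g. g \<in> Lip0 p \<and> lipnorm g \<le> 1 \<and> Sup (V n) - inverse (real (Suc n)) < norm (\<phi> n g)"
    proof
      fix n
      have "Sup (V n) - inverse (real (Suc n)) < Sup (V n)" by simp
      then obtain v where "v \<in> V n" "Sup (V n) - inverse (real (Suc n)) < v"
        using less_cSupD[of "V n"] V0 by blast
      then show "\<exists>g. g \<in> Lip0 p \<and> lipnorm g \<le> 1 \<and> Sup (V n) - inverse (real (Suc n)) < norm (\<phi> n g)"
        by (auto simp: V_def dual_vals_def)
    qed
    from choice[OF this] obtain G where G: "\<And>n. G n \<in> Lip0 p" "\<And>n. lipnorm (G n) \<le> 1"
      "\<And>n. Sup (V n) - inverse (real (Suc n)) < norm (\<phi> n (G n))" by blast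
    have G_lip: "1-lipschitz_on UNIV (G n)" "G n p = 0" for n
      using G(1,2) lipnorm_le_1_iff[OF G(1)] by (auto simp: Lip0_def)
    \<comment> \<open>The remainder part vanishes uniformly. The other part is a finite sum with
      coefficients bounded by \<open>dist y p\<close>, so weak convergence on the fixed
      \<open>h y\<close> controls it.\<close>
    have \<phi>G: "\<phi> n (G n) = T n (\<lambda>z. G n z - E (G n) z) + (\<Sum>y\<in>Q. G n y * (T n (h y) - \<gamma> (h y)))" for n
      unfolding \<phi>_def T_eq[OF G(1)] \<gamma>_eq[OF G(1)] T_split[of n "G n"]
      by (simp add: right_diff_distrib sum_subtractf mult.commute)
    have "(\<lambda>n. G n y * (T n (h y) - \<gamma> (h y))) \<longlonglongrightarrow> 0" if "y \<in> Q" for y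
    proof (rule Lim_null_comparison)
      show "\<forall>\<^sub>F n in sequentially. norm (G n y * (T n (h y) - \<gamma> (h y))) \<le> dist y p * norm (T n (h y) - \<gamma> (h y))"
        using size[OF G_lip] by (intro always_eventually allI) (simp add: norm_mult mult_right_mono)
      have "(\<lambda>n. dist y p * norm (T n (h y) - \<gamma> (h y))) \<longlonglongrightarrow> dist y p * norm (\<gamma> (h y) - \<gamma> (h y))"
        using T_lim[OF h_Lip0[OF that]] by (intro tendsto_intros)
      then show "(\<lambda>n. dist y p * norm (T n (h y) - \<gamma> (h y))) \<longlonglongrightarrow> 0" by simp
    qed
    then have "(\<lambda>n. \<phi> n (G n)) \<longlonglongrightarrow> 0 + 0"
      unfolding \<phi>G using vanish[OF G_lip] by (intro tendsto_add tendsto_null_sum) auto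
    then have "(\<lambda>n. norm (\<phi> n (G n)) + inverse (real (Suc n))) \<longlonglongrightarrow> 0 + 0"
      by (intro tendsto_add LIMSEQ_inverse_real_of_nat tendsto_norm_zero) simp
    then have lim: "(\<lambda>n. norm (\<phi> n (G n)) + inverse (real (Suc n))) \<longlonglongrightarrow> 0" by simp
    have "(\<lambda>n. Sup (V n)) \<longlonglongrightarrow> 0"
    proof (rule tendsto_sandwich[OF _ _ tendsto_const lim])
      show "\<forall>\<^sub>F n in sequentially. 0 \<le> Sup (V n)"
        using cSup_upper[OF V0 bdd] by simp
      show "\<forall>\<^sub>F n in sequentially. Sup (V n) \<le> norm (\<phi> n (G n)) + inverse (real (Suc n))"
        using G(3) by (auto simp: algebra_simps less_imp_le)
    qed
    then show ?thesis by (simp add: V_def dual_norm_def \<phi>_def[abs_def])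
  qed
  ultimately show ?thesis using r by blast
qed

text \<open>A subsequence with norms bounded away from 0 would still converge weakly, hence have a
  further subsequence converging in norm, which is impossible.\<close>

lemma FS_weak_limit:
  fixes p :: "'a::metric_space"
    and \<gamma> :: "('a \<Rightarrow> 'k::{real_normed_field,euclidean_space}) \<Rightarrow> 'k"
  assumes "complete (UNIV :: 'a set)"
    and "\<And>n. \<gamma>s n \<in> FS p k" and "\<gamma> \<in> FreeSp p" and wc: "weak_conv p \<gamma>s \<gamma>"
  shows "\<gamma> \<in> FS p k \<and> norm_conv p \<gamma>s \<gamma>"
proof
  show "\<gamma> \<in> FS p k" using weak_limit_subseq[OF assms] by blast
  define N where "N n = dual_norm p (\<lambda>g. \<gamma>s n g - \<gamma> g)" for n
  have "N \<longlonglongrightarrow> 0"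
  proof (rule ccontr)
    assume "\<not> N \<longlonglongrightarrow> 0"
    then obtain e where e: "e > 0" "\<not> (\<forall>\<^sub>F n in sequentially. dist (N n) 0 < e)"
      by (auto simp: tendsto_iff)
    then have "infinite {n. e \<le> \<bar>N n\<bar>}"
      by (auto simp: infinite_nat_iff_unbounded_le eventually_sequentially not_less)
    from infinite_enumerate[OF this] obtain s :: "nat \<Rightarrow> nat"
      where s: "strict_mono s" "\<forall>n. s n \<in> {n. e \<le> \<bar>N n\<bar>}" by blast
    have "weak_conv p (\<lambda>n. \<gamma>s (s n)) \<gamma>"
      using wc LIMSEQ_subseq_LIMSEQ[OF _ s(1)] unfolding weak_conv_def o_def by blast
    from weak_limit_subseq[OF assms(1) assms(2) assms(3) this]
    obtain r where "(\<lambda>n. N (s (r n))) \<longlonglongrightarrow> 0" by (auto simp: N_def)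
    then have "\<forall>\<^sub>F n in sequentially. dist (N (s (r n))) 0 < e" using e(1) by (rule tendstoD)
    then obtain n where "\<bar>N (s (r n))\<bar> < e" by (auto simp: eventually_sequentially)
    then show False using s(2)[rule_format, of "r n"] by simp
  qed
  then show "norm_conv p \<gamma>s \<gamma>" by (simp add: norm_conv_def N_def[abs_def])
qed

theorem theoremC:
  fixes p :: "'a::metric_space" and k :: nat
  assumes "complete (UNIV :: 'a set)"
  shows "(\<forall>(\<gamma>s :: nat \<Rightarrow> (('a \<Rightarrow> real) \<Rightarrow> real)) \<gamma>.
            (\<forall>n. \<gamma>s n \<in> FS p k) \<and> \<gamma> \<in> FreeSp p \<and> weak_conv p \<gamma>s \<gamma>
              \<longrightarrow> \<gamma> \<in> FS p k \<and> norm_conv p \<gamma>s \<gamma>)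
       \<and> (\<forall>(\<gamma>s :: nat \<Rightarrow> (('a \<Rightarrow> complex) \<Rightarrow> complex)) \<gamma>.
            (\<forall>n. \<gamma>s n \<in> FS p k) \<and> \<gamma> \<in> FreeSp p \<and> weak_conv p \<gamma>s \<gamma>
              \<longrightarrow> \<gamma> \<in> FS p k \<and> norm_conv p \<gamma>s \<gamma>)"
  by (intro conjI allI impI; elim conjE; blast dest: FS_weak_limit[OF assms, rotated])

end
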